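(* Let $r$ be a positive integer, let $b_1,\dots,b_r$ be nonzero real numbers, and let $y_1,\dots,y_r$ be real numbers. For any integers $n_1,\dots,n_r\ge0$ and any real $x$, $$\widehat{I}_{n_1,\dots,n_r}(x;b;y)=\sum_{a=0}^{n_1+\cdots+n_{r-1}}(-1)^{a}\sum_{j_1+\cdots+j_{r-1}=a}\binom{a}{j_1,\dots,j_{r-1}}\,b_1^{j_1}\cdots b_{r-1}^{j_{r-1}}\,b_r^{-a-1}\,\widehat{C}_{n_1-j_1,\dots,n_{r-1}-j_{r-1},\,n_r+a+1}(x;b;y),$$ where the inner sum is over nonnegative integers $j_1,\dots,j_{r-1}$ with sum $a$.
   Context: $B_n(x)$ denotes the $n$th Bernoulli polynomial, defined by $\frac{te^{xt}}{e^t-1}=\sum_{n\ge0}B_n(x)\frac{t^n}{n!}$ ($|t|<2\pi$). The multinomial coefficient is $\binom{a}{j_1,\dots,j_{m}}=\frac{a!}{j_1!\cdots j_{m}!}$ for $j_1+\cdots+j_m=a$, $j_i\ge0$. Write $b=(b_1,\dots,b_r)$, $y=(y_1,\dots,y_r)$ and $$\widehat{I}_{n_1,\dots,n_r}(x;b;y)=\frac{1}{n_1!\cdots n_r!}\int_0^x B_{n_1}(b_1z+y_1)\cdots B_{n_r}(b_rz+y_r)\,dz,$$ $$\widehat{C}_{n_1,\dots,n_r}(x;b;y)=\frac{1}{n_1!\cdots n_r!}\left(\prod_{l=1}^{r}B_{n_l}(b_lx+y_l)-\prod_{l=1}^{r}B_{n_l}(y_l)\right).$$ Conventions: $\widehat{C}_{n_1,\dots,n_r}(x;b;y)=0$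 whenever some index $n_l$ is negative. When $r=1$ the outer sum has only the term $a=0$ and the inner sum consists of a single (empty) term with coefficient $1$. *)

theory Defs
  imports "HOL-Complex_Analysis.Complex_Analysis"
begin

text \<open>
  The generating function is taken as a quotient of formal power series: the denominator
  \<open>e\<^sup>t - 1\<close> has subdegree 1, so this is a genuine power series. The theorem
  \<open>bernoulli_poly_sums\<close> below shows that it also converges to the analytic
  generating function for all complex \<open>t\<close> with \<open>0 < \<bar>t\<bar> < 2\<pi>\<close>.
\<close>

definition bernoulli_poly :: "nat \<Rightarrow> real \<Rightarrow> real" where
  "bernoulli_poly n x = fact n * fps_nth (fps_X * fps_exp x / (fps_exp 1 - 1)) n"

lemma bernoulli_poly_fps_complex:
  "Abs_fps (\<lambda>n. complex_of_real (bernoulli_poly n x / fact n)) =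
     fps_X * fps_exp (of_real x) / (fps_exp 1 - 1)"
proof -
  define F :: "real fps" where "F = fps_X * fps_exp x / (fps_exp 1 - 1)"
  define G where "G = Abs_fps (\<lambda>n. complex_of_real (fps_nth F n))"
  have nz: "fps_exp 1 - 1 \<noteq> (0 :: real fps)" "fps_exp 1 - 1 \<noteq> (0 :: complex fps)"
    by (auto simp: fps_eq_iff intro!: exI[of _ 1])
  have sd: "subdegree (fps_exp 1 - 1 :: real fps) = 1"
    by (rule subdegreeI) auto
  have "fps_exp 1 - 1 dvd fps_X * fps_exp x"
    using nz(1) by (subst fps_dvd_iff) (simp_all add: sd del: subdegree_minus_commute)
  hence F: "F * (fps_exp 1 - 1) = fps_X * fps_exp x"
    unfolding F_def by simp
  have "G * (fps_exp 1 - 1) = fps_X * fps_exp (of_real x)"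
  proof (rule fps_ext)
    fix n
    have "fps_nth (G * (fps_exp 1 - 1)) n = of_real (fps_nth (F * (fps_exp 1 - 1)) n)"
      by (simp add: fps_mult_nth G_def if_distrib cong: if_cong)
    also have "\<dots> = fps_nth (fps_X * fps_exp (of_real x)) n"
      unfolding F by (cases n) (auto simp: fps_X_mult_nth)
    finally show "fps_nth (G * (fps_exp 1 - 1)) n = fps_nth (fps_X * fps_exp (of_real x)) n" .
  qed
  hence "G = fps_X * fps_exp (of_real x) / (fps_exp 1 - 1)"
    using nz(2) by (metis nonzero_mult_div_cancel_right)
  thus ?thesis
    by (simp add: G_def F_def bernoulli_poly_def)
qed

theorem bernoulli_poly_sums:
  fixes t :: complex and x :: real
  assumes "t \<noteq> 0" and "norm t < 2 * pi"
  shows "(\<lambda>n. of_real (bernoulli_poly n x) * t ^ n / fact n) sums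
           (t * exp (of_real x * t) / (exp t - 1))"
proof -
  define f where "f = (\<lambda>t. if t = 0 then 1 else t * exp (of_real x * t) / (exp t - 1 :: complex))"
  define F :: "complex fps" where "F = fps_X * fps_exp (of_real x) / (fps_exp 1 - 1)"
  have nz: "fps_exp 1 - 1 \<noteq> (0 :: complex fps)"
    by (auto simp: fps_eq_iff intro!: exI[of _ 1])
  have sd: "subdegree (fps_exp 1 - 1 :: complex fps) = 1"
    by (rule subdegreeI) auto
  have exp: "f has_fps_expansion F"
    unfolding f_def F_def
  proof (rule has_fps_expansion_divide)
    show "(\<lambda>t. t * exp (complex_of_real x * t)) has_fps_expansion fps_X * fps_exp (of_real x)"
      by (intro fps_expansion_intros)
    show "(\<lambda>t. exp t - 1) has_fps_expansion fps_exp 1 - (1 :: complex fps)"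
      by (intro fps_expansion_intros)
    show "subdegree (fps_exp 1 - 1 :: complex fps) \<le> subdegree (fps_X * fps_exp (complex_of_real x))"
      unfolding sd by simp
    show "1 = fps_nth (fps_X * fps_exp (complex_of_real x)) (subdegree (fps_exp 1 - 1 :: complex fps)) /
              fps_nth (fps_exp 1 - 1) (subdegree (fps_exp 1 - 1 :: complex fps))"
      unfolding sd by simp
  qed (rule nz)
  have exp_ne: "exp z \<noteq> 1" if "z \<in> ball 0 (2 * pi) - {0}" for z :: complex
  proof
    assume "exp z = 1"
    then obtain n :: int where n: "Re z = 0" "Im z = of_int (2 * n) * pi"
      by (auto simp: exp_eq_1)
    hence "norm z = 2 * pi * \<bar>real_of_int n\<bar>"
      by (simp add: cmod_def abs_mult)
    with that have "\<bar>real_of_int n\<bar> < 1"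
      by simp
    hence "n = 0"
      by linarith
    with n that show False
      by (auto simp: complex_eq_iff)
  qed
  have hol: "f holomorphic_on ball 0 (2 * pi) - {0}"
  proof (rule holomorphic_transform)
    show "(\<lambda>t. t * exp (of_real x * t) / (exp t - 1)) holomorphic_on ball 0 (2 * pi) - {0}"
      using exp_ne by (intro holomorphic_intros) auto
  qed (auto simp: f_def)
  have "f \<midarrow>0\<rightarrow> f 0"
    using has_fps_expansion_imp_continuous[OF exp, of UNIV] by (simp add: continuous_within)
  hence "(f \<longlongrightarrow> f 0) (at 0 within ball 0 (2 * pi))"
    by (rule tendsto_within_subset) (rule subset_UNIV)
  hence "f holomorphic_on ball 0 (2 * pi)"
    by (intro no_isolated_singularity'[OF _ hol]) simp_all
  hence "(\<lambda>n. fps_nth F n * t ^ n) sums f t"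
    using has_fps_expansion_imp_sums_complex[OF exp, of "2 * pi" t] assms by simp
  moreover have "fps_nth F n * t ^ n = of_real (bernoulli_poly n x) * t ^ n / fact n" for n
    unfolding F_def bernoulli_poly_fps_complex[symmetric] by simp
  ultimately show ?thesis
    using assms by (simp add: f_def)
qed

text \<open>
  Tuples \<open>(v\<^sub>1, \<dots>, v\<^sub>r)\<close> are functions on \<open>nat\<close> of which only the values at
  \<open>1, \<dots>, r\<close> are used. The integral is oriented, so \<open>x\<close> may be negative.
\<close>

definition I_hat ::
  "nat \<Rightarrow> (nat \<Rightarrow> nat) \<Rightarrow> real \<Rightarrow> (nat \<Rightarrow> real) \<Rightarrow> (nat \<Rightarrow> real) \<Rightarrow> real" where
  "I_hat r n x b y =
     1 / (\<Prod>l=1..r. fact (n l)) *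
     (LBINT z=0..x. (\<Prod>l=1..r. bernoulli_poly (n l) (b l * z + y l)))"

text \<open>The indices are integers because the convention for negative indices is part of the definition.\<close>

definition C_hat ::
  "nat \<Rightarrow> (nat \<Rightarrow> int) \<Rightarrow> real \<Rightarrow> (nat \<Rightarrow> real) \<Rightarrow> (nat \<Rightarrow> real) \<Rightarrow> real" where
  "C_hat r n x b y =
     (if \<exists>l\<in>{1..r}. n l < 0 then 0
      else 1 / (\<Prod>l=1..r. fact (nat (n l))) *
           ((\<Prod>l=1..r. bernoulli_poly (nat (n l)) (b l * x + y l)) -
            (\<Prod>l=1..r. bernoulli_poly (nat (n l)) (y l))))"

text \<open>
  Weak compositions of \<open>a\<close> into \<open>m\<close> parts. The extensional function space contains each tuple
  exactly once; for \<open>m = 0\<close> it contains exactly one (empty) tuple, which has sum 0.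
\<close>

definition weak_compositions :: "nat \<Rightarrow> nat \<Rightarrow> (nat \<Rightarrow> nat) set" where
  "weak_compositions m a = {j \<in> {1..m} \<rightarrow>\<^sub>E UNIV. (\<Sum>i=1..m. j i) = a}"

text \<open>Used only when the \<open>j\<^sub>i\<close> sum to \<open>a\<close>.\<close>

definition multinomial :: "nat \<Rightarrow> nat \<Rightarrow> (nat \<Rightarrow> nat) \<Rightarrow> real" where
  "multinomial m a j = fact a / (\<Prod>i=1..m. fact (j i))"

lemma finite_weak_compositions: "finite (weak_compositions m a)"
proof (rule finite_subset)
  show "weak_compositions m a \<subseteq> {1..m} \<rightarrow>\<^sub>E {0..a}"
  proof
    fix j assume "j \<in> weak_compositions m a"
    hence j: "j \<in> {1..m} \<rightarrow>\<^sub>E UNIV" "sum j {1..m} = a"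
      by (auto simp only: weak_compositions_def mem_Collect_eq)
    have "j i \<le> a" if "i \<in> {1..m}" for i
      unfolding j(2)[symmetric] using that by (intro member_le_sum) auto
    thus "j \<in> {1..m} \<rightarrow>\<^sub>E {0..a}"
      using j(1) unfolding PiE_iff by simp
  qed
qed (rule finite_PiE, simp_all)

end

theory Submission
  imports Defs
begin

text \<open>
  The formula is repeated integration by parts. Write \<open>\<beta>\<^sub>k = B\<^sub>k / k!\<close>, with \<open>\<beta>\<^sub>k = 0\<close> for
  \<open>k < 0\<close>; then \<open>\<beta>\<^sub>k' = \<beta>\<^bsub>k-1\<^esub>\<close> for every integer \<open>k\<close>. Let \<open>S\<^sub>a\<close> be the \<open>a\<close>-th derivative of
  the product of the first \<open>r - 1\<close> factors \<open>\<beta>\<^bsub>n\<^sub>l\<^esub>(b\<^sub>l z + y\<^sub>l)\<close>. By the multinomial Leibniz rule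
  (\<open>has_field_derivative_multinomial_Leibniz\<close>), \<open>S\<^sub>a\<close> is the sum over the weak compositions of
  \<open>a\<close> that occurs in the theorem. The function
  \<open>H(z) = \<Sum>\<^sub>a (-1)\<^sup>a b\<^sub>r\<^sup>-\<^sup>a\<^sup>-\<^sup>1 S\<^sub>a(z) \<beta>\<^bsub>n\<^sub>r+a+1\<^esub>(b\<^sub>r z + y\<^sub>r)\<close>, with \<open>a\<close> running from \<open>0\<close> to
  \<open>N = n\<^sub>1 + \<dots> + n\<^bsub>r-1\<^esub>\<close>, has a derivative that telescopes to the integrand plus a multiple of
  \<open>S\<^bsub>N+1\<^esub>\<close>. The latter vanishes, as every composition of \<open>N + 1\<close> has some part \<open>j\<^sub>i > n\<^sub>i\<close>. The right-hand
  side of the theorem is \<open>H(x) - H(0)\<close>, and the formula is the fundamental theorem of calculus for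
  \<open>H\<close>.
\<close>

section \<open>Normalised Bernoulli polynomials\<close>

text \<open>
  The normalised Bernoulli polynomial \<open>B\<^sub>k(x) / k!\<close>, extended by zero to negative \<open>k\<close>, which makes
  the derivative rule hold for all integers \<open>k\<close>.
\<close>

definition bernoulli_normalised :: "int \<Rightarrow> real \<Rightarrow> real" where
  "bernoulli_normalised k x = (if k < 0 then 0 else bernoulli_poly (nat k) x / fact (nat k))"

lemma bernoulli_poly_explicit:
  "bernoulli_poly n x / fact n =
     (\<Sum>i=0..n. fps_nth (fps_X / (fps_exp 1 - 1)) i * (x ^ (n - i) / fact (n - i)))"
proof -
  define E :: "real fps" where "E = fps_exp 1 - 1"
  have nz: "E \<noteq> 0"
    by (auto simp: E_def fps_eq_iff intro!: exI[of _ 1])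
  have sd: "subdegree E = 1"
    unfolding E_def by (rule subdegreeI) auto
  have "E dvd fps_X"
    using nz by (subst fps_dvd_iff) (simp_all add: sd)
  hence "fps_X * fps_exp x / E = fps_X / E * fps_exp x"
    by (simp add: dvd_div_mult)
  thus ?thesis
    by (simp add: bernoulli_poly_def E_def fps_mult_nth)
qed

lemma has_field_derivative_bernoulli_normalised:
  "(bernoulli_normalised k has_field_derivative bernoulli_normalised (k - 1) x) (at x)"
proof (cases "k \<le> 0")
  case True
  have "bernoulli_poly 0 x = bernoulli_poly 0 0" for x
    using bernoulli_poly_explicit[of 0 x] bernoulli_poly_explicit[of 0 0] by simp
  hence "bernoulli_normalised k = (\<lambda>x. bernoulli_normalised k 0)"
    using True unfolding bernoulli_normalised_def by (intro ext) simp
  moreover have "((\<lambda>x. bernoulli_normalised k 0) has_field_derivative 0) (at x)"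
    by simp
  ultimately show ?thesis
    using True by (simp add: bernoulli_normalised_def)
next
  case False
  define n where "n = nat (k - 1)"
  have k: "k = int (Suc n)"
    using False by (simp add: n_def)
  define c :: "nat \<Rightarrow> real" where "c = fps_nth (fps_X / (fps_exp 1 - 1))"
  have eq: "bernoulli_normalised (int p) x = (\<Sum>i=0..p. c i * (x ^ (p - i) / fact (p - i)))"
    for p x
    by (simp add: bernoulli_normalised_def bernoulli_poly_explicit c_def)
  have monom_deriv: "((\<lambda>x. c i * (x ^ (Suc n - i) / fact (Suc n - i)))
      has_field_derivative c i * (x ^ (n - i) / fact (n - i))) (at x)" if "i \<in> {0..n}" for i
  proof -
    have Suc: "Suc n - i = Suc (n - i)"
      using that by simp
    show ?thesis
      unfolding Suc by (rule DERIV_cmult, rule DERIV_cong[OF DERIV_cdivide[OF DERIV_pow]])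
        (simp add: field_simps del: of_nat_Suc)
  qed
  have "((\<lambda>x. (\<Sum>i=0..n. c i * (x ^ (Suc n - i) / fact (Suc n - i))) + c (Suc n))
      has_field_derivative (\<Sum>i=0..n. c i * (x ^ (n - i) / fact (n - i))) + 0) (at x)"
    by (intro DERIV_add DERIV_sum monom_deriv) auto
  moreover have "bernoulli_normalised k =
      (\<lambda>x. (\<Sum>i=0..n. c i * (x ^ (Suc n - i) / fact (Suc n - i))) + c (Suc n))"
    unfolding k by (intro ext) (simp only: eq sum.atLeast0_atMost_Suc, simp)
  moreover have "k - 1 = int n"
    by (simp add: k)
  ultimately show ?thesis
    by (simp only: eq add_0_right)
qed

text \<open>
  The zero extension of \<open>bernoulli_normalised\<close> absorbs the convention that \<open>C_hat\<close> vanishes when an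
  index is negative.
\<close>

lemma C_hat_eq_diff_prod:
  "C_hat r u x b y = (\<Prod>l=1..r. bernoulli_normalised (u l) (b l * x + y l)) -
                     (\<Prod>l=1..r. bernoulli_normalised (u l) (y l))"
proof (cases "\<exists>l\<in>{1..r}. u l < 0")
  case True
  then obtain l where "l \<in> {1..r}" "u l < 0"
    by auto
  hence zero: "(\<Prod>l=1..r. bernoulli_normalised (u l) (f l)) = 0" for f
    by (intro prod_zero) (auto simp: bernoulli_normalised_def)
  from True show ?thesis
    unfolding zero by (simp add: C_hat_def)
next
  case False
  hence "(\<Prod>l=1..r. bernoulli_normalised (u l) (f l)) =
      (\<Prod>l=1..r. bernoulli_poly (nat (u l)) (f l)) / (\<Prod>l=1..r. fact (nat (u l)))" for f
    unfolding prod_dividef[symmetric]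
    by (intro prod.cong refl) (force simp: bernoulli_normalised_def)
  with False show ?thesis
    by (simp add: C_hat_def diff_divide_distrib)
qed

section \<open>The multinomial Leibniz rule\<close>

text \<open>
  One step of the multinomial Leibniz rule: \<open>f i k\<close> plays the role of the \<open>k\<close>-th derivative of the
  \<open>i\<close>-th factor.
\<close>

lemma has_field_derivative_multinomial_Leibniz:
  fixes f :: "nat \<Rightarrow> nat \<Rightarrow> real \<Rightarrow> real"
  assumes f: "\<And>i k. i \<in> {1..m} \<Longrightarrow> (f i k has_field_derivative f i (Suc k) z) (at z)"
  shows "((\<lambda>z. \<Sum>j\<in>weak_compositions m a. multinomial m a j * (\<Prod>i=1..m. f i (j i) z))
    has_field_derivative
      (\<Sum>j\<in>weak_compositions m (Suc a). multinomial m (Suc a) j * (\<Prod>i=1..m. f i (j i) z))) (at z)"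
proof -
  define P where "P = (\<lambda>j. \<Prod>i=1..m. f i (j i) z)"
  define up where "up = (\<lambda>(j :: nat \<Rightarrow> nat, i). (j(i := Suc (j i)), i))"
  define down where "down = (\<lambda>(j :: nat \<Rightarrow> nat, i). (j(i := j i - 1), i))"
  have upd_sum: "(\<Sum>l=1..m. (j(i := v)) l) + j i = (\<Sum>l=1..m. j l) + v"
    if "i \<in> {1..m}" for i v and j :: "nat \<Rightarrow> nat"
  proof -
    have "(\<Sum>l\<in>{1..m} - {i}. (j(i := v)) l) = (\<Sum>l\<in>{1..m} - {i}. j l)"
      by (intro sum.cong) auto
    thus ?thesis
      using sum.remove[OF _ that, of j] sum.remove[OF _ that, of "j(i := v)"]
      by (simp del: fun_upd_apply add: fun_upd_same)
  qed
  have upd_fact: "(\<Prod>l=1..m. fact ((j(i := Suc (j i))) l)) = real (Suc (j i)) * (\<Prod>l=1..m. fact (j l))"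
    if "i \<in> {1..m}" for i and j :: "nat \<Rightarrow> nat"
  proof -
    have "(\<Prod>l\<in>{1..m} - {i}. fact ((j(i := Suc (j i))) l) :: real) =
        (\<Prod>l\<in>{1..m} - {i}. fact (j l))"
      by (intro prod.cong) auto
    thus ?thesis
      using prod.remove[OF _ that, of "\<lambda>l. fact (j l) :: real"]
        prod.remove[OF _ that, of "\<lambda>l. fact ((j(i := Suc (j i))) l) :: real"]
      by (simp del: fun_upd_apply of_nat_Suc add: fun_upd_same)
  qed
  have prod_deriv: "((\<lambda>z. \<Prod>i=1..m. f i (j i) z) has_field_derivative
      (\<Sum>i=1..m. P (j(i := Suc (j i))))) (at z)" for j
  proof -
    have "((\<lambda>z. \<Prod>i=1..m. f i (j i) z) has_field_derivative
      (\<Sum>i=1..m. f i (Suc (j i)) z * (\<Prod>l\<in>{1..m} - {i}. f l (j l) z))) (at z)"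
      using f by (intro has_field_derivative_prod) auto
    also have "(\<Sum>i=1..m. f i (Suc (j i)) z * (\<Prod>l\<in>{1..m} - {i}. f l (j l) z)) =
      (\<Sum>i=1..m. P (j(i := Suc (j i))))"
    proof (intro sum.cong refl)
      fix i assume i: "i \<in> {1..m}"
      have "(\<Prod>l\<in>{1..m} - {i}. f l ((j(i := Suc (j i))) l) z) = (\<Prod>l\<in>{1..m} - {i}. f l (j l) z)"
        by (intro prod.cong) auto
      thus "f i (Suc (j i)) z * (\<Prod>l\<in>{1..m} - {i}. f l (j l) z) = P (j(i := Suc (j i)))"
        using prod.remove[OF _ i, of "\<lambda>l. f l ((j(i := Suc (j i))) l) z"]
        by (simp add: P_def del: fun_upd_apply add: fun_upd_same)
    qed
    finally show ?thesis .
  qed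
  have "(\<Sum>j\<in>weak_compositions m a. multinomial m a j * (\<Sum>i=1..m. P (j(i := Suc (j i))))) =
    (\<Sum>(j, i)\<in>weak_compositions m a \<times> {1..m}. multinomial m a j * P (j(i := Suc (j i))))"
    by (simp add: sum_distrib_left sum.cartesian_product)
  \<comment> \<open>Substitute \<open>j'\<close> for the tuple \<open>j\<close> with its \<open>i\<close>-th part raised by one; the factor \<open>j'\<^sub>i\<close> comes
    from \<open>j'\<^sub>i! = j'\<^sub>i j\<^sub>i!\<close>. Summed over \<open>i\<close>, these factors give \<open>a + 1\<close>, which turns \<open>a!\<close> into
    \<open>(a + 1)!\<close>.\<close>
  also have "\<dots> = (\<Sum>(j, i)\<in>(SIGMA j:weak_compositions m (Suc a). {i\<in>{1..m}. j i \<noteq> 0}).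
      real (j i) * (fact a / (\<Prod>l=1..m. fact (j l))) * P j)"
  proof (rule sum.reindex_bij_witness[of _ down up], goal_cases)
    case (1 p)
    thus ?case by (auto simp: up_def down_def)
  next
    case (2 p)
    then obtain j i where p: "p = (j, i)" "j \<in> weak_compositions m a" "i \<in> {1..m}"
      by auto
    have "j(i := Suc (j i)) \<in> {1..m} \<rightarrow>\<^sub>E UNIV"
      using p(2,3) by (auto simp: weak_compositions_def PiE_iff extensional_def)
    moreover have "(\<Sum>l=1..m. (j(i := Suc (j i))) l) = Suc a"
      using upd_sum[OF p(3), of j "Suc (j i)"] p(2) by (simp add: weak_compositions_def)
    ultimately show ?case
      using p(3) by (simp add: p(1) up_def weak_compositions_def del: fun_upd_apply add: fun_upd_same)
  next
    case (3 p)
    thus ?case by (auto simp: up_def down_def)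
  next
    case (4 p)
    then obtain j i where p: "p = (j, i)" "j \<in> weak_compositions m (Suc a)" "i \<in> {1..m}" "j i \<noteq> 0"
      by auto
    have "j(i := j i - 1) \<in> {1..m} \<rightarrow>\<^sub>E UNIV"
      using p(2,3) by (auto simp: weak_compositions_def PiE_iff extensional_def)
    moreover have "(\<Sum>l=1..m. (j(i := j i - 1)) l) = a"
      using upd_sum[OF p(3), of j "j i - 1"] p(2,4) by (simp add: weak_compositions_def)
    ultimately show ?case
      using p(3) by (simp add: p(1) down_def weak_compositions_def del: fun_upd_apply)
  next
    case (5 p)
    then obtain j i where p: "p = (j, i)" "i \<in> {1..m}"
      by auto
    show ?case
      by (simp only: p(1) up_def multinomial_def prod.case upd_fact[OF p(2)] fun_upd_same)
         (simp del: of_nat_Suc fun_upd_apply)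
  qed
  also have "\<dots> = (\<Sum>j\<in>weak_compositions m (Suc a). \<Sum>i\<in>{i\<in>{1..m}. j i \<noteq> 0}.
      real (j i) * (fact a / (\<Prod>l=1..m. fact (j l))) * P j)"
    by (rule sum.Sigma[symmetric]) (auto intro: finite_weak_compositions)
  also have "\<dots> = (\<Sum>j\<in>weak_compositions m (Suc a). multinomial m (Suc a) j * P j)"
  proof (intro sum.cong refl)
    fix j assume j: "j \<in> weak_compositions m (Suc a)"
    have "(\<Sum>i\<in>{i\<in>{1..m}. j i \<noteq> 0}. real (j i) * (fact a / (\<Prod>l=1..m. fact (j l))) * P j) =
        (\<Sum>i=1..m. real (j i) * (fact a / (\<Prod>l=1..m. fact (j l))) * P j)"
      by (intro sum.mono_neutral_left) auto
    also have "\<dots> = real (\<Sum>i=1..m. j i) * (fact a / (\<Prod>l=1..m. fact (j l))) * P j"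
      by (simp only: of_nat_sum sum_distrib_right)
    also have "(\<Sum>i=1..m. j i) = Suc a"
      using j by (simp add: weak_compositions_def)
    finally show "(\<Sum>i\<in>{i\<in>{1..m}. j i \<noteq> 0}. real (j i) * (fact a / (\<Prod>l=1..m. fact (j l))) * P j) =
        multinomial m (Suc a) j * P j"
      by (simp add: multinomial_def)
  qed
  finally have "(\<Sum>j\<in>weak_compositions m a. multinomial m a j * (\<Sum>i=1..m. P (j(i := Suc (j i))))) =
    (\<Sum>j\<in>weak_compositions m (Suc a). multinomial m (Suc a) j * P j)" .
  moreover have "((\<lambda>z. \<Sum>j\<in>weak_compositions m a. multinomial m a j * (\<Prod>i=1..m. f i (j i) z))
    has_field_derivative
      (\<Sum>j\<in>weak_compositions m a. multinomial m a j * (\<Sum>i=1..m. P (j(i := Suc (j i)))))) (at z)"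
    by (intro DERIV_sum DERIV_cmult prod_deriv)
  ultimately show ?thesis
    by (simp only: P_def)
qed

lemma weak_compositions_0: "weak_compositions m 0 = {\<lambda>i\<in>{1..m}. 0}"
  by (auto simp: weak_compositions_def PiE_iff extensional_def fun_eq_iff)

section \<open>Iterated integration by parts\<close>

theorem proposition11:
  fixes r :: nat and n :: "nat \<Rightarrow> nat" and b y :: "nat \<Rightarrow> real" and x :: real
  assumes "r \<ge> 1"
    and "\<And>l. l \<in> {1..r} \<Longrightarrow> b l \<noteq> 0"
  shows "I_hat r n x b y =
    (\<Sum>a = 0..(\<Sum>l=1..r - 1. n l). (-1) ^ a *
      (\<Sum>j\<in>weak_compositions (r - 1) a.
         multinomial (r - 1) a j * (\<Prod>i=1..r - 1. b i ^ j i) * b r powi (- int a - 1) *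
         C_hat r (\<lambda>l. if l = r then int (n r) + int a + 1 else int (n l) - int (j l)) x b y))"
proof -
  define m where "m = r - 1"
  have r: "r = Suc m"
    using assms(1) by (simp add: m_def)
  have br: "b r \<noteq> 0"
    using assms by auto
  define N where "N = (\<Sum>l=1..m. n l)"
  \<comment> \<open>\<open>f i k\<close> is the \<open>k\<close>-th derivative of the \<open>i\<close>-th factor of the integrand \<open>F\<close>.\<close>
  define f where
    "f = (\<lambda>i k z. b i ^ k * bernoulli_normalised (int (n i) - int k) (b i * z + y i))"
  define S where
    "S = (\<lambda>a z. \<Sum>j\<in>weak_compositions m a. multinomial m a j * (\<Prod>i=1..m. f i (j i) z))"
  define G where "G = (\<lambda>k z. bernoulli_normalised (int (n r) + int k) (b r * z + y r))"
  define H where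
    "H = (\<lambda>z. \<Sum>a=0..N. (-1) ^ a * b r powi (- int a - 1) * (S a z * G (Suc a) z))"
  define F where "F = (\<lambda>z. \<Prod>l=1..r. bernoulli_normalised (int (n l)) (b l * z + y l))"

  note bernoulli_deriv =
    DERIV_chain2[OF has_field_derivative_bernoulli_normalised]
  have f_deriv: "(f i k has_field_derivative f i (Suc k) z) (at z)" for i k z
    unfolding f_def
    by (rule derivative_eq_intros bernoulli_deriv refl)+ (simp add: algebra_simps)
  have S_deriv: "(S a has_field_derivative S (Suc a) z) (at z)" for a z
    unfolding S_def by (rule has_field_derivative_multinomial_Leibniz) (rule f_deriv)
  have G_deriv: "(G (Suc k) has_field_derivative b r * G k z) (at z)" for k z
    unfolding G_def
    by (rule DERIV_cong, (rule derivative_eq_intros bernoulli_deriv refl)+) (simp add: algebra_simps)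

  have S_0: "S 0 z * G 0 z = F z" for z
    by (simp add: S_def f_def G_def F_def weak_compositions_0 multinomial_def r)
  have S_vanishes: "S (Suc N) z = 0" for z
    unfolding S_def
  proof (intro sum.neutral ballI)
    fix j assume j: "j \<in> weak_compositions m (Suc N)"
    have "\<exists>i\<in>{1..m}. n i < j i"
    proof (rule ccontr)
      assume "\<not> (\<exists>i\<in>{1..m}. n i < j i)"
      hence "(\<Sum>i=1..m. j i) \<le> N"
        unfolding N_def by (intro sum_mono) (auto simp: not_less)
      with j show False
        by (simp add: weak_compositions_def)
    qed
    hence "(\<Prod>i=1..m. f i (j i) z) = 0"
      by (intro prod_zero) (auto simp: f_def bernoulli_normalised_def)
    thus "multinomial m (Suc N) j * (\<Prod>i=1..m. f i (j i) z) = 0"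
      by simp
  qed

  have H_deriv: "(H has_field_derivative F z) (at z)" for z
  proof -
    \<comment> \<open>The \<open>a\<close>-th summand of \<open>H\<close> has derivative \<open>T a - T (Suc a)\<close>.\<close>
    define T where "T = (\<lambda>a. (-1) ^ a * b r powi (- int a) * (S a z * G a z))"
    have "(H has_field_derivative
      (\<Sum>a=0..N. (-1) ^ a * b r powi (- int a - 1) *
         (S (Suc a) z * G (Suc a) z + b r * G a z * S a z))) (at z)"
      unfolding H_def by (intro DERIV_sum DERIV_cmult DERIV_mult S_deriv G_deriv)
    also have "(\<Sum>a=0..N. (-1) ^ a * b r powi (- int a - 1) *
         (S (Suc a) z * G (Suc a) z + b r * G a z * S a z)) = (\<Sum>a=0..N. T a - T (Suc a))"
    proof (intro sum.cong refl)
      fix a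
      have exps: "- int (Suc a) = - int a - 1" "b r powi (- int a) = b r powi (- int a - 1) * b r"
        using br power_int_add_1[of "b r" "- int a - 1"] by auto
      show "(-1) ^ a * b r powi (- int a - 1) *
         (S (Suc a) z * G (Suc a) z + b r * G a z * S a z) = T a - T (Suc a)"
        by (simp only: T_def exps power_Suc) (simp add: algebra_simps)
    qed
    also have "\<dots> = T 0 - T (Suc N)"
      by (induction N) auto
    also have "\<dots> = F z"
      by (simp add: T_def S_0 S_vanishes)
    finally show ?thesis .
  qed

  have "continuous_on UNIV (bernoulli_normalised k)" for k
    by (rule DERIV_continuous_on) (rule has_field_derivative_bernoulli_normalised)
  hence "continuous_on UNIV (\<lambda>z. bernoulli_normalised k (c * z + d))" for k c d
    by (rule continuous_on_compose2) (auto intro!: continuous_intros)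
  hence "continuous_on UNIV F"
    unfolding F_def by (intro continuous_on_prod)
  hence "(LBINT z=ereal 0..ereal x. F z) = H x - H 0"
    using H_deriv
    by (intro interval_integral_FTC_finite)
       (auto intro: continuous_on_subset has_vector_derivative_at_within
             simp: has_real_derivative_iff_has_vector_derivative)
  moreover have "I_hat r n x b y = (LBINT z=0..x. F z)"
  proof -
    have "F = (\<lambda>z. 1 / (\<Prod>l=1..r. fact (n l)) *
        (\<Prod>l=1..r. bernoulli_poly (n l) (b l * z + y l)))"
      by (simp add: F_def bernoulli_normalised_def prod_dividef)
    thus ?thesis
      by (simp only: I_hat_def interval_lebesgue_integral_mult_right)
  qed
  ultimately have I: "I_hat r n x b y = H x - H 0"
    by (simp add: zero_ereal_def)

  have factor: "(\<Prod>l=1..r. bernoulli_normalised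
        (if l = r then int (n r) + int a + 1 else int (n l) - int (j l)) (b l * z + y l)) =
      (\<Prod>i=1..m. bernoulli_normalised (int (n i) - int (j i)) (b i * z + y i)) * G (Suc a) z"
    for a j z
    by (simp add: r G_def add_ac)
  have summand: "(\<Prod>i=1..m. b i ^ j i) *
      C_hat r (\<lambda>l. if l = r then int (n r) + int a + 1 else int (n l) - int (j l)) x b y =
      (\<Prod>i=1..m. f i (j i) x) * G (Suc a) x - (\<Prod>i=1..m. f i (j i) 0) * G (Suc a) 0" for a j
    unfolding C_hat_eq_diff_prod factor f_def prod.distrib
    using factor[of a j 0] by (simp add: algebra_simps)
  have "H x - H 0 = (\<Sum>a=0..N. (-1) ^ a * b r powi (- int a - 1) *
      (S a x * G (Suc a) x - S a 0 * G (Suc a) 0))"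
    by (simp add: H_def sum_subtractf right_diff_distrib)
  also have "\<dots> = (\<Sum>a=0..N. (-1) ^ a *
      (\<Sum>j\<in>weak_compositions m a. multinomial m a j * b r powi (- int a - 1) *
         ((\<Prod>i=1..m. b i ^ j i) *
          C_hat r (\<lambda>l. if l = r then int (n r) + int a + 1 else int (n l) - int (j l)) x b y)))"
    unfolding summand S_def
    by (simp add: sum_distrib_left sum_distrib_right sum_subtractf algebra_simps)
  finally show ?thesis
    unfolding I by (simp add: N_def m_def mult_ac)
qed

end
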